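(* For every set of terms $X$ and term $t$ (with $X\cup\{t\}$ normalized), if $X \vdash_{\textit{dy}} t$, then there is a normal proof of $X \vdash t$.
   Context: Terms: fix a set $N$ of names (atoms) containing distinguished names $0$ and $\mathsf{secret}$, a subset $\mathcal{K}\subseteq N$ of keys, and a set $V$ of variables. Terms are generated by $t,t' ::= x \mid m \mid \mathsf{pk}(k) \mid \mathsf{pair}(t,t') \mid \mathsf{senc}(t,t') \mid \mathsf{aenc}(t,\mathsf{pk}(k)) \mid \bigoplus M$, where $x\in V$, $m\in N$, $k\in\mathcal{K}$ and $M$ is a finite multiset of terms; $t_1\oplus\cdots\oplus t_n$ denotes $\bigoplus\{t_1,\dots,t_n\}$. Terms of the form $\bigoplus M$ are non-standard, all others standard; by convention $\bigoplus\{t\}:=t$ for standard $t$ and $\bigoplus\emptyset:=0$. Factors: $\mathrm{fac}(t)=\{t\}$ for standard $t$, and $\mathrm{fac}(\bigoplus M)$ is the multiset union of $\mathrm{fac}(u)$, $u\in M$. Normal form: $\mathrm{nf}(a)=a$ for $a\in N\cup V$; $\mathrm{nf}(\mathsf{pk}(k))=\mathsf{pk}(k)$; $\mathrm{nf}(\mathsf{f}(u,v))=\mathsf{f}(\mathrm{nf}(u),\mathrm{nf}(v))$ for $\mathsf f\in\{\mathsf{pair},\mathsf{senc},\mathsf{aenc}\}$; for non-standard $r$, $\mathrm{nf}(r)=\bigoplus\{v \mid \sum_{u:\,\mathrm{nf}(u)=v}(\text{number of occurrences of } u \text{ in } \mathrm{fac}(r)) \text{ is odd}\}$. A term is normalized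 if $\mathrm{nf}(t)=t$. (This captures associativity, commutativity, nilpotence $x\oplus x=0$ and unit $0$.) Derivation rules (premises above, conclusion below): $\mathsf{ax}$ (no premises, conclusion any $t$); $\mathsf{split}$: from $\mathsf{pair}(t_1,t_2)$ infer $t_i$ ($i=1,2$); $\mathsf{sdec}$: from $\mathsf{senc}(u,v)$ and $v$ infer $u$; $\mathsf{adec}$: from $\mathsf{aenc}(u,\mathsf{pk}(k))$ and $k$ infer $u$; $\mathsf{pk}$: from $k$ infer $\mathsf{pk}(k)$; $\mathsf{pair}$: from $u,v$ infer $\mathsf{pair}(u,v)$; $\mathsf{senc}$: from $u,v$ infer $\mathsf{senc}(u,v)$; $\mathsf{aenc}$: from $u$ and $\mathsf{pk}(k)$ infer $\mathsf{aenc}(u,\mathsf{pk}(k))$; $\mathsf{xor}$: from $t_1,\dots,t_n$ infer $\mathrm{nf}(t_1\oplus\cdots\oplus t_n)$. Destructor rules: $\mathsf{ax},\mathsf{split},\mathsf{sdec},\mathsf{adec}$, and $\mathsf{xor}$ when its conclusion is standard (called $\mathsf{xor}_d$); constructor rules: $\mathsf{pk},\mathsf{pair},\mathsf{senc},\mathsf{aenc}$, and $\mathsf{xor}$ when its conclusion is non-standard (called $\mathsf{xor}_c$). A derivation (proof) is a finite tree whose nodes are labelled $(t,\mathsf r)$ with $t$ a normalized term and $\mathsf r$ a rule, leaves labelled with $\mathsf{ax}$, and each node with its children forming an instance of its rule (children's terms as premises, node's term as conclusion). $\mathrm{conc}(\pi)$ is the root term, $\mathrm{lr}(\pi)$ the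 root rule, $\mathrm{axioms}(\pi)$ the set of leaf terms. $\pi$ proves $X\vdash t$ if $\mathrm{axioms}(\pi)\subseteq X$ and $\mathrm{conc}(\pi)=t$; $X\vdash_{\textit{dy}}t$ means such a proof exists (always with $X\cup\{t\}$ normalized). A proof is normal if (1) no occurrence of $\mathsf{split},\mathsf{sdec},\mathsf{adec}$ has its leftmost premise being the conclusion of a constructor rule; and (2) in every occurrence of $\mathsf{xor}$: no two premises are the same, no premise equals the conclusion, and no premise is the conclusion of an $\mathsf{xor}$ rule.
   Formalization: The xor rule may also be used with no premises, concluding 0, so leaves are ax nodes or such empty xor nodes (otherwise the claim fails for X={a}, t=0), and the name 0, being the empty sum, is taken to have no factors. *)

theory Defs
  imports "HOL-Library.Multiset"
begin

class names =
  fixes zero_name :: 'a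
    and secret_name :: 'a
    and keys :: "'a set"
  assumes zero_name_neq_secret_name: "zero_name \<noteq> secret_name"

text \<open>
  \<open>AEnc t k\<close> stands for \<open>aenc(t, pk(k))\<close>. Not every element of this datatype is a term: see
  \<open>is_term\<close> below.
\<close>

datatype ('n, 'v) trm =
    Var 'v
  | Name 'n
  | Pk 'n
  | TPair "('n, 'v) trm" "('n, 'v) trm"
  | SEnc "('n, 'v) trm" "('n, 'v) trm"
  | AEnc "('n, 'v) trm" 'n
  | Xor "('n, 'v) trm multiset"

definition standard :: "('n, 'v) trm \<Rightarrow> bool" where
  "standard t \<longleftrightarrow> (\<forall>M. t \<noteq> Xor M)"

text \<open>
  The operation \<open>\<Oplus>M\<close> subject to the conventions \<open>\<Oplus>{t} = t\<close> for standard \<open>t\<close> and \<open>\<Oplus>\<emptyset> = 0\<close>.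
\<close>

definition bigxor :: "('n::names, 'v) trm multiset \<Rightarrow> ('n, 'v) trm" where
  "bigxor M =
     (if M = {#} then Name zero_name
      else if \<exists>t. standard t \<and> M = {#t#} then (THE t. M = {#t#})
      else Xor M)"

text \<open>
  Since \<open>\<Oplus>\<close> is formed by \<open>bigxor\<close>, the constructor \<open>Xor\<close> is never applied to the empty multiset or
  to a singleton of a standard term.
\<close>

inductive is_term :: "('n::names, 'v) trm \<Rightarrow> bool" where
  "is_term (Var x)"
| "is_term (Name m)"
| "k \<in> keys \<Longrightarrow> is_term (Pk k)"
| "is_term t \<Longrightarrow> is_term t' \<Longrightarrow> is_term (TPair t t')"
| "is_term t \<Longrightarrow> is_term t' \<Longrightarrow> is_term (SEnc t t')"
| "is_term t \<Longrightarrow> k \<in> keys \<Longrightarrow> is_term (AEnc t k)"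
| "(\<forall>t\<in>#M. is_term t) \<Longrightarrow> is_term (bigxor M)"

text \<open>
  By the convention \<open>0 = \<Oplus>\<emptyset>\<close>, the name 0 has no factors; this is what makes it the unit of \<open>\<oplus>\<close>.
\<close>

lemma size_less_Xor: "w \<in># M \<Longrightarrow> size w < size (Xor M)"
  by (auto dest!: multi_member_split)

function fac :: "('n::names, 'v) trm \<Rightarrow> ('n, 'v) trm multiset" where
  "fac (Xor M) = \<Sum>\<^sub># (image_mset fac M)"
| "fac (Name m) = (if m = zero_name then {#} else {#Name m#})"
| "fac (Var x) = {#Var x#}"
| "fac (Pk k) = {#Pk k#}"
| "fac (TPair u v) = {#TPair u v#}"
| "fac (SEnc u v) = {#SEnc u v#}"
| "fac (AEnc u k) = {#AEnc u k#}"
  by pat_completeness auto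
termination
  by (relation "measure size") (auto simp del: trm.size intro: size_less_Xor)

lemma fac_size: "u \<in># fac t \<Longrightarrow> size u \<le> size t"
proof (induction t arbitrary: u)
  case (Xor M)
  then obtain w where w: "w \<in># M" "u \<in># fac w" by auto
  with Xor.IH have "size u \<le> size w" by blast
  also have "size w \<le> size (Xor M)"
    using size_less_Xor[OF w(1)] by simp
  finally show ?case .
qed (auto split: if_splits)

lemma fac_Xor_size: "u \<in># fac (Xor M) \<Longrightarrow> size u < size (Xor M)"
proof -
  assume "u \<in># fac (Xor M)"
  then obtain w where w: "w \<in># M" "u \<in># fac w" by auto
  have "size u \<le> size w" using w(2) by (rule fac_size)
  also have "size w < size (Xor M)"
    using w(1) by (rule size_less_Xor)
  finally show ?thesis .
qed

text \<open>
  The multiplicity of \<open>v\<close> in \<open>image_mset nf (fac r)\<close> is the sum of the multiplicities in \<open>fac r\<close> of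
  all \<open>u\<close> with \<open>nf u = v\<close>.
\<close>

function nf :: "('n::names, 'v) trm \<Rightarrow> ('n, 'v) trm" where
  "nf (Var x) = Var x"
| "nf (Name m) = Name m"
| "nf (Pk k) = Pk k"
| "nf (TPair u v) = TPair (nf u) (nf v)"
| "nf (SEnc u v) = SEnc (nf u) (nf v)"
| "nf (AEnc u k) = AEnc (nf u) k"
| "nf (Xor M) = bigxor (mset_set {v. odd (count (image_mset nf (fac (Xor M))) v)})"
  by pat_completeness auto
termination
  by (relation "measure size") (auto simp del: fac.simps dest: fac_Xor_size)

definition normalized :: "('n::names, 'v) trm \<Rightarrow> bool" where
  "normalized t \<longleftrightarrow> is_term t \<and> nf t = t"

datatype rule = R_ax | R_split | R_sdec | R_adec | R_pk | R_pair | R_senc | R_aenc | R_xor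

text \<open>
  \<open>rule_instance r ts t\<close>: the terms \<open>ts\<close> (from left to right) are the premises and \<open>t\<close> the conclusion
  of an instance of \<open>r\<close>. The rule \<open>R_xor\<close> takes any number of premises; without premises it
  yields \<open>nf (\<Oplus>\<emptyset>) = 0\<close>. Hence the childless nodes of a derivation are \<open>R_ax\<close> nodes and such empty
  \<open>R_xor\<close> nodes, and only the former contribute to \<open>axioms\<close>. Without the empty instance, normal
  proofs need not exist: from a name \<open>a \<noteq> 0\<close> one obtains 0 by \<open>R_xor\<close> with premises \<open>a, a\<close>, but no
  nonempty family of pairwise distinct terms derivable from \<open>a\<close> without \<open>R_xor\<close> sums up to 0.
\<close>

inductive rule_instance ::
  "rule \<Rightarrow> ('n::names, 'v) trm list \<Rightarrow> ('n, 'v) trm \<Rightarrow> bool" where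
  "rule_instance R_ax [] t"
| "rule_instance R_split [TPair t1 t2] t1"
| "rule_instance R_split [TPair t1 t2] t2"
| "rule_instance R_sdec [SEnc u v, v] u"
| "k \<in> keys \<Longrightarrow> rule_instance R_adec [AEnc u k, Name k] u"
| "k \<in> keys \<Longrightarrow> rule_instance R_pk [Name k] (Pk k)"
| "rule_instance R_pair [u, v] (TPair u v)"
| "rule_instance R_senc [u, v] (SEnc u v)"
| "k \<in> keys \<Longrightarrow> rule_instance R_aenc [u, Pk k] (AEnc u k)"
| "rule_instance R_xor ts (nf (bigxor (mset ts)))"

datatype ('n, 'v) ptree =
  Node (conc: "('n, 'v) trm") (lr: rule) (children: "('n, 'v) ptree list")

inductive derivation :: "('n::names, 'v) ptree \<Rightarrow> bool" where
  "\<lbrakk>normalized t; \<forall>p\<in>set ps. derivation p; rule_instance r (map conc ps) t\<rbrakk>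
     \<Longrightarrow> derivation (Node t r ps)"

fun axioms :: "('n, 'v) ptree \<Rightarrow> ('n, 'v) trm set" where
  "axioms (Node t r ps) = (if r = R_ax then {t} else (\<Union>p\<in>set ps. axioms p))"

definition proves :: "('n::names, 'v) ptree \<Rightarrow> ('n, 'v) trm set \<Rightarrow> ('n, 'v) trm \<Rightarrow> bool" where
  "proves p X t \<longleftrightarrow> derivation p \<and> axioms p \<subseteq> X \<and> conc p = t"

definition derives_dy :: "('n::names, 'v) trm set \<Rightarrow> ('n, 'v) trm \<Rightarrow> bool"
    (infix \<open>\<turnstile>\<^sub>d\<^sub>y\<close> 50) where
  "X \<turnstile>\<^sub>d\<^sub>y t \<longleftrightarrow> (\<exists>p. proves p X t)"

definition ends_with_constructor :: "('n, 'v) ptree \<Rightarrow> bool" where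
  "ends_with_constructor p \<longleftrightarrow>
     lr p \<in> {R_pk, R_pair, R_senc, R_aenc} \<or> (lr p = R_xor \<and> \<not> standard (conc p))"

fun normal :: "('n, 'v) ptree \<Rightarrow> bool" where
  "normal (Node t r ps) \<longleftrightarrow>
     (\<forall>p\<in>set ps. normal p) \<and>
     (r \<in> {R_split, R_sdec, R_adec} \<longrightarrow> \<not> ends_with_constructor (hd ps)) \<and>
     (r = R_xor \<longrightarrow>
        distinct (map conc ps) \<and>
        t \<notin> set (map conc ps) \<and>
        (\<forall>p\<in>set ps. lr p \<noteq> R_xor))"

end

theory Submission imports Defs begin

text \<open>
  Terms with normal proofs are closed under every rule. A destructor applied to the conclusion of a
  matching constructor is replaced by a subproof of that constructor. For \<open>\<oplus>\<close>, a premise that is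
  itself obtained by \<open>\<oplus>\<close> is replaced by its own premises, and equal premises are cancelled in pairs;
  neither changes, for any \<open>v\<close>, the parity of the number of factors with normal form \<open>v\<close>, and these
  parities determine the conclusion. If the conclusion ends up among the premises, the proof of that
  premise is taken instead.
\<close>

section \<open>Parities of factors\<close>

text \<open>A vector over the two-element field, given by its support: multiset sum becomes
  symmetric difference.\<close>

definition odd_factors :: "('n::names, 'v) trm multiset \<Rightarrow> ('n, 'v) trm set" where
  "odd_factors M = {v. odd (count (image_mset nf (\<Sum>\<^sub># (image_mset fac M))) v)}"

lemma finite_odd_count: "finite {v. odd (count M v)}"
  by (rule finite_subset[of _ "set_mset M"]) (auto intro: ccontr simp: not_in_iff)

lemma finite_odd_factors: "finite (odd_factors M)"
  unfolding odd_factors_def by (rule finite_odd_count)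

lemma odd_factors_union:
  "odd_factors (M + N) = {v. (v \<in> odd_factors M) \<noteq> (v \<in> odd_factors N)}"
  by (auto simp: odd_factors_def)

lemma odd_factors_union_cong:
  assumes "odd_factors M = odd_factors M'" "odd_factors N = odd_factors N'"
  shows "odd_factors (M + N) = odd_factors (M' + N')"
  by (simp only: odd_factors_union assms)

lemma odd_factors_add_mset_cong:
  assumes "odd_factors M = odd_factors N"
  shows "odd_factors (add_mset t M) = odd_factors (add_mset t N)"
  using odd_factors_union_cong[OF refl assms, of "{#t#}"] by simp

lemma odd_factors_cancel: "odd_factors (add_mset t (add_mset t M)) = odd_factors M"
  by (auto simp: odd_factors_def)

section \<open>Normal forms of sums\<close>

lemma bigxor_empty [simp]: "bigxor {#} = Name zero_name"
  by (simp add: bigxor_def)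

lemma bigxor_single [simp]: "standard t \<Longrightarrow> bigxor {#t#} = t"
  by (auto simp: bigxor_def)

lemma bigxor_cases:
  obtains "bigxor M = Xor M" | "M = {#}" | t where "standard t" "M = {#t#}"
  unfolding bigxor_def by metis

lemma fac_bigxor: "fac (bigxor M) = \<Sum>\<^sub># (image_mset fac M)"
  by (rule bigxor_cases[of M]) auto

lemma fac_standard: "standard t \<Longrightarrow> t \<noteq> Name zero_name \<Longrightarrow> fac t = {#t#}"
  by (cases t) (auto simp: standard_def)

lemma standard_nf: "standard t \<Longrightarrow> standard (nf t)"
  by (cases t) (auto simp: standard_def)

lemma nf_eq_zero_standard: "standard t \<Longrightarrow> nf t = Name zero_name \<Longrightarrow> t = Name zero_name"
  by (cases t) (auto simp: standard_def)

lemma mem_fac: "u \<in># fac t \<Longrightarrow> standard u \<and> u \<noteq> Name zero_name"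
proof (induction t)
  case (Xor M)
  then show ?case by auto
qed (auto simp: standard_def split: if_splits)

text \<open>The conclusion of \<open>R_xor\<close> thus depends on the premises only through
  \<open>odd_factors\<close>, so they may be rearranged freely as long as this set is kept.\<close>

lemma nf_bigxor: "nf (bigxor M) = bigxor (mset_set (odd_factors M))"
proof (cases M rule: bigxor_cases)
  case (3 t)
  show ?thesis
  \<comment> \<open>The name 0 has no factors, so here \<open>odd_factors M\<close> is empty and the
    right-hand side is 0 by the convention for the empty sum.\<close>
  proof (cases "t = Name zero_name")
    case True
    with 3 show ?thesis by (simp add: odd_factors_def standard_def)
  next
    case False
    with 3 have "odd_factors M = {nf t}"
      by (auto simp: odd_factors_def fac_standard split: if_splits)
    with 3 show ?thesis by (simp add: standard_nf)
  qed
qed (simp_all add: odd_factors_def)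

lemma mem_odd_factors:
  assumes "v \<in> odd_factors M"
  obtains t u where "t \<in># M" "u \<in># fac t" "v = nf u"
proof -
  have "v \<in># image_mset nf (\<Sum>\<^sub># (image_mset fac M))"
    using assms unfolding odd_factors_def by (metis (mono_tags) even_zero mem_Collect_eq not_in_iff)
  then show ?thesis using that by auto
qed

text \<open>Each member is its own only factor and its own normal form, hence is counted exactly
  once.\<close>

lemma odd_factors_mset_set:
  assumes "finite S"
    and S: "\<And>v. v \<in> S \<Longrightarrow> standard v \<and> v \<noteq> Name zero_name \<and> nf v = v"
  shows "odd_factors (mset_set S) = S"
proof -
  have "image_mset fac (mset_set S) = image_mset (\<lambda>v. {#v#}) (mset_set S)"
    using assms by (intro image_mset_cong) (simp add: fac_standard)
  then have "\<Sum>\<^sub># (image_mset fac (mset_set S)) = mset_set S" by simp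
  moreover have "image_mset nf (mset_set S) = mset_set S"
    using assms image_mset_cong[of "mset_set S" nf "\<lambda>v. v"] by simp
  ultimately show ?thesis using \<open>finite S\<close> by (auto simp: odd_factors_def count_mset_set')
qed

text \<open>Induction on size rather than structure, since \<open>nf\<close> recurses into the
  factors of a sum, which may lie below its immediate summands.\<close>

lemma nf_nf: "nf (nf t) = nf t"
proof (induction t rule: measure_induct_rule[of size])
  case (less t)
  show ?case
  proof (cases t)
    case (Xor M)
    let ?S = "odd_factors {#t#}"
    have nf: "nf t = bigxor (mset_set ?S)"
      using Xor by (simp add: odd_factors_def)
    have "standard v \<and> v \<noteq> Name zero_name \<and> nf v = v" if v: "v \<in> ?S" for v
    proof -
      obtain u where u: "u \<in># fac t" "v = nf u"
        using v by (rule mem_odd_factors) simp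
      moreover have "size u < size t"
        using u(1) fac_Xor_size unfolding Xor by blast
      ultimately show ?thesis
        using mem_fac[OF u(1)] less by (auto simp: standard_nf dest: nf_eq_zero_standard)
    qed
    then have "odd_factors (mset_set ?S) = ?S"
      by (rule odd_factors_mset_set[OF finite_odd_factors])
    then show ?thesis by (simp add: nf nf_bigxor)
  qed (use less in simp_all)
qed

text \<open>This allows a conclusion of \<open>R_xor\<close> to be exchanged for its premises inside
  a larger sum. By \<open>nf_nf\<close>, the odd factors are themselves in normal form, so summing
  them gives back the same set.\<close>

lemma odd_factors_nf_bigxor: "odd_factors {#nf (bigxor M)#} = odd_factors M"
proof -
  have "standard v \<and> v \<noteq> Name zero_name \<and> nf v = v" if "v \<in> odd_factors M" for v
    using that
    by (auto elim!: mem_odd_factors simp: nf_nf standard_nf dest!: mem_fac dest: nf_eq_zero_standard)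
  then have "odd_factors (mset_set (odd_factors M)) = odd_factors M"
    by (rule odd_factors_mset_set[OF finite_odd_factors])
  then show ?thesis by (simp add: nf_bigxor odd_factors_def fac_bigxor)
qed

section \<open>Normal proofs and closure under the rules\<close>

definition normal_proof :: "('n::names, 'v) trm set \<Rightarrow> ('n, 'v) ptree \<Rightarrow> bool" where
  "normal_proof X p \<longleftrightarrow> derivation p \<and> axioms p \<subseteq> X \<and> normal p"

lemma derivation_Node:
  "derivation (Node t r ps) \<longleftrightarrow>
    normalized t \<and> (\<forall>p\<in>set ps. derivation p) \<and> rule_instance r (map conc ps) t"
  by (subst derivation.simps) simp

lemma normal_proof_child:
  assumes "normal_proof X (Node t r ps)" "p \<in> set ps"
  shows "normal_proof X p"
proof -
  \<comment> \<open>\<open>axioms\<close> does not look below an \<open>R_ax\<close> node, but such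
    a node has no children.\<close>
  have "r \<noteq> R_ax"
    using assms by (auto simp: normal_proof_def derivation_Node elim: rule_instance.cases)
  then show ?thesis using assms by (auto simp: normal_proof_def derivation_Node)
qed

lemma normal_proof_NodeI:
  assumes "normalized t" "rule_instance r (map conc ps) t" "\<forall>p\<in>set ps. normal_proof X p"
    and "r \<noteq> R_ax" "normal (Node t r ps)"
  shows "normal_proof X (Node t r ps)"
  using assms by (auto simp: normal_proof_def derivation_Node)

lemma derivation_rule_instance: "derivation p \<Longrightarrow> rule_instance (lr p) (map conc (children p)) (conc p)"
  by (cases p) (simp add: derivation_Node)

text \<open>Unfolding one level suffices: a normal proof ending in \<open>R_xor\<close> has no
  premise that ends in \<open>R_xor\<close>.\<close>

lemma flatten_xor_premises:
  assumes "\<forall>p\<in>set ps. normal_proof X p"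
  shows "\<exists>qs. (\<forall>q\<in>set qs. normal_proof X q \<and> lr q \<noteq> R_xor) \<and>
    odd_factors (mset (map conc qs)) = odd_factors (mset (map conc ps))"
  using assms
proof (induction ps)
  case Nil
  show ?case by (intro exI[of _ "[]"]) simp
next
  case (Cons p ps)
  then obtain qs where qs: "\<forall>q\<in>set qs. normal_proof X q \<and> lr q \<noteq> R_xor"
      "odd_factors (mset (map conc qs)) = odd_factors (mset (map conc ps))"
    by auto
  show ?case
  proof (cases "lr p = R_xor")
    case False
    with qs(1) Cons.prems odd_factors_add_mset_cong[OF qs(2), of "conc p"] show ?thesis
      by (intro exI[of _ "p # qs"]) simp
  next
    case True
    obtain t rs where p: "p = Node t R_xor rs" using True by (cases p) auto
    have pn: "normal_proof X (Node t R_xor rs)" using Cons.prems p by simp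
    have t: "t = nf (bigxor (mset (map conc rs)))"
      using pn derivation_rule_instance[of p] p by (auto simp: normal_proof_def rule_instance.simps)
    have "\<forall>q\<in>set rs. normal_proof X q \<and> lr q \<noteq> R_xor"
      using normal_proof_child[OF pn] pn by (auto simp: normal_proof_def)
    moreover have "odd_factors (mset (map conc (rs @ qs))) = odd_factors (mset (map conc (p # ps)))"
      using odd_factors_union_cong[OF odd_factors_nf_bigxor[symmetric, of "mset (map conc rs)"] qs(2)]
      by (simp add: p t)
    ultimately show ?thesis using qs(1) by (intro exI[of _ "rs @ qs"]) auto
  qed
qed

lemma cancel_equal_premises:
  "\<exists>qs. set qs \<subseteq> set ps \<and> distinct (map conc qs) \<and>
    odd_factors (mset (map conc qs)) = odd_factors (mset (map conc ps))"
proof (induction ps)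
  case Nil
  show ?case by simp
next
  case (Cons p ps)
  then obtain qs where qs: "set qs \<subseteq> set ps" "distinct (map conc qs)"
      "odd_factors (mset (map conc qs)) = odd_factors (mset (map conc ps))"
    by auto
  show ?case
  proof (cases "conc p \<in> set (map conc qs)")
    case False
    with qs(1,2) odd_factors_add_mset_cong[OF qs(3), of "conc p"] show ?thesis
      by (intro exI[of _ "p # qs"]) auto
  next
    case True
    then obtain q where q: "q \<in> set qs" "conc q = conc p" by auto
    then obtain as bs where qs': "qs = as @ q # bs" by (meson split_list)
    have ps: "odd_factors (mset (map conc ps)) =
        odd_factors (add_mset (conc p) (mset (map conc (as @ bs))))"
      using qs(3) by (simp add: qs' q)
    \<comment> \<open>Instead of adding \<open>p\<close>, the earlier \<open>q\<close> is dropped: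
      together they contribute the same term twice.\<close>
    have "odd_factors (mset (map conc (p # ps))) = odd_factors (mset (map conc (as @ bs)))"
      using odd_factors_add_mset_cong[OF ps, of "conc p"] by (simp add: odd_factors_cancel)
    with qs qs' show ?thesis by (intro exI[of _ "as @ bs"]) auto
  qed
qed

lemma normal_proof_xor:
  assumes ps: "\<forall>p\<in>set ps. normal_proof X p"
    and t: "t = nf (bigxor (mset (map conc ps)))" and "normalized t"
  shows "\<exists>q. normal_proof X q \<and> conc q = t"
proof -
  obtain rs where rs: "\<forall>q\<in>set rs. normal_proof X q \<and> lr q \<noteq> R_xor"
      "odd_factors (mset (map conc rs)) = odd_factors (mset (map conc ps))"
    using flatten_xor_premises[OF ps] by blast
  \<comment> \<open>Cancellation follows flattening, which may create repetitions; it only selects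
    from \<open>rs\<close>, so no premise ending in \<open>R_xor\<close> reappears.\<close>
  obtain qs where qs: "set qs \<subseteq> set rs" "distinct (map conc qs)"
      "odd_factors (mset (map conc qs)) = odd_factors (mset (map conc rs))"
    using cancel_equal_premises by blast
  show ?thesis
  proof (cases "t \<in> set (map conc qs)")
    case True
    with qs(1) rs(1) show ?thesis by auto
  next
    case False
    have "t = nf (bigxor (mset (map conc qs)))"
      using qs(3) rs(2) t by (simp only: nf_bigxor)
    \<comment> \<open>If everything cancels, this is the instance without premises, and
      \<open>t\<close> is 0.\<close>
    then have "rule_instance R_xor (map conc qs) t"
      by (simp only: rule_instance.intros)
    moreover have "normal (Node t R_xor qs)"
      using False qs rs(1) by (auto simp: normal_proof_def)
    ultimately have "normal_proof X (Node t R_xor qs)"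
      using \<open>normalized t\<close> qs(1) rs(1) by (intro normal_proof_NodeI) auto
    then show ?thesis by (intro exI[of _ "Node t R_xor qs"]) simp
  qed
qed

lemma normal_proof_destructor:
  assumes ps: "\<forall>p\<in>set (q # ps). normal_proof X p"
    and inst: "rule_instance r (map conc (q # ps)) t" and r: "r \<in> {R_split, R_sdec, R_adec}"
    and "normalized t"
  shows "\<exists>q'. normal_proof X q' \<and> conc q' = t"
proof (cases "ends_with_constructor q")
  case False
  then have "normal_proof X (Node t r (q # ps))"
    using assms by (intro normal_proof_NodeI) (auto simp: normal_proof_def)
  then show ?thesis by (intro exI[of _ "Node t r (q # ps)"]) simp
next
  case True
  have "rule_instance (lr q) (map conc (children q)) (conc q)"
    using ps by (intro derivation_rule_instance) (auto simp: normal_proof_def)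
  \<comment> \<open>The destructor forces \<open>conc q\<close> to be a pair or an encryption, hence
    standard. This excludes \<open>R_xor\<close> and \<open>R_pk\<close>, so \<open>q\<close> ends
    with the matching constructor, which has \<open>t\<close> among its premises.\<close>
  then have "\<exists>c\<in>set (children q). conc c = t"
    using True inst r
    by (auto simp: ends_with_constructor_def standard_def elim!: rule_instance.cases)
  moreover have "normal_proof X c" if "c \<in> set (children q)" for c
    using that ps normal_proof_child[of X "conc q" "lr q" "children q"] by auto
  ultimately show ?thesis by blast
qed

lemma normalization:
  assumes "derivation p" "axioms p \<subseteq> X"
  shows "\<exists>q. normal_proof X q \<and> conc q = conc p"
  using assms
proof (induction p rule: derivation.induct)
  case (1 t ps r)
  show ?case
  proof (cases "r = R_ax")
    case True
    with 1 have "normal_proof X (Node t r ps)"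
      by (auto simp: normal_proof_def derivation_Node elim: rule_instance.cases)
    then show ?thesis by (intro exI[of _ "Node t r ps"]) simp
  next
    case False
    with 1 have "\<forall>p\<in>set ps. \<exists>q. normal_proof X q \<and> conc q = conc p" by auto
    \<comment> \<open>Since \<open>f\<close> preserves conclusions, replacing the subproofs leaves
      the instance of \<open>r\<close> intact.\<close>
    then obtain f where f: "\<forall>p\<in>set ps. normal_proof X (f p) \<and> conc (f p) = conc p"
      by metis
    define qs where "qs = map f ps"
    have qs: "\<forall>q\<in>set qs. normal_proof X q" "map conc qs = map conc ps"
      using f by (auto simp: qs_def)
    have inst: "rule_instance r (map conc qs) t" using 1 qs(2) by simp
    consider "r = R_xor" | "r \<in> {R_split, R_sdec, R_adec}" | "r \<in> {R_pk, R_pair, R_senc, R_aenc}"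
      using False by (cases r) auto
    then have "\<exists>q. normal_proof X q \<and> conc q = t"
    proof cases
      case 1
      with inst have "t = nf (bigxor (mset (map conc qs)))"
        by (auto simp: rule_instance.simps)
      then show ?thesis using normal_proof_xor qs(1) \<open>normalized t\<close> by blast
    next
      case 2
      then obtain q qs' where "qs = q # qs'"
        using inst by (cases qs) (auto elim: rule_instance.cases)
      with 2 inst qs(1) \<open>normalized t\<close> show ?thesis using normal_proof_destructor by blast
    next
      \<comment> \<open>For these rules \<open>normal\<close> demands nothing beyond normality of
        the subproofs.\<close>
      case 3
      then have "normal_proof X (Node t r qs)"
        using inst qs(1) \<open>normalized t\<close>
        by (intro normal_proof_NodeI) (auto simp: normal_proof_def)
      then show ?thesis by (intro exI[of _ "Node t r qs"]) simp
    qed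
    then show ?thesis by simp
  qed
qed

theorem mainTheorem1:
  fixes X :: "('n::names, 'v) trm set" and t :: "('n, 'v) trm"
  assumes "\<forall>u\<in>X \<union> {t}. normalized u"
    and "X \<turnstile>\<^sub>d\<^sub>y t"
  shows "\<exists>p. proves p X t \<and> normal p"
  using assms(2) normalization unfolding derives_dy_def proves_def normal_proof_def by blast

end
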